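(* Let $n\ge 2$ and $1\le k\le n-1$ be integers, let $\Delta_{k,n}=\{x\in[0,1]^n : \sum_{i=1}^n x_i=k\}$ be the hypersimplex, and let $\mathrm{ehr}(\Delta_{k,n},t)$ be its Ehrhart polynomial. Then for every integer $0\le m\le n-1$, the coefficient of $t^m$ in $(n-1)!\,\mathrm{ehr}(\Delta_{k,n},t)$ equals the number of $(1,\dots,1)$-compatible cycle-ordered, weighted permutations $(\sigma,p,w)$ of type $(n,m+1,k)$.
   Context: For a polytope $P\subset\mathbb{R}^n$ with integral vertices, $\mathrm{ehr}(P,t)$ is the polynomial in $t$ with $\mathrm{ehr}(P,t)=\#(tP\cap\mathbb{Z}^n)$ for all positive integers $t$. For a permutation $\sigma$, $C(\sigma)$ denotes the set of cycles in its cycle decomposition (fixed points count as cycles of length 1). For a permutation $p=[p_1,\dots,p_r]$ of $[r]=\{1,\dots,r\}$ in one-line notation, $\mathrm{Des}(p)=\{1\le i\le r-1 : p_i>p_{i+1}\}$ and $\mathrm{des}(p)=|\mathrm{Des}(p)|$. A cycle-ordered, weighted permutation of $[n]$ is a triple $(\sigma,p,w)$ where $\sigma$ is a permutation of $[n]$; $p$ is a permutation of $[r]$ with $p(r)=1$, where $r=|C(\sigma)|$; and $w:C(\sigma)\to\mathbb{N}_0=\{0,1,2,\dots\}$ is a function. The value $w(\mathfrak{c})$ is called the weight of the cycle $\mathfrak{c}$, and the total weight is $w(\sigma)=\sum_{\mathfrak{c}\in C(\sigma)}w(\mathfrak{c})$. The triple $(\sigma,p,w)$ is of type $(n,r,k)$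 if $|C(\sigma)|=r$ and $k=w(\sigma)+\mathrm{des}(p)$. For a tuple $\mathbf{c}=(c_1,\dots,c_n)$ of positive integers, $(\sigma,p,w)$ is $\mathbf{c}$-compatible if $w(\mathfrak{c})<\sum_{i\in\mathfrak{c}}c_i$ for all $\mathfrak{c}\in C(\sigma)$. In particular, $(1,\dots,1)$-compatible means that the weight of each cycle is strictly less than its length. *)

theory Defs
  imports
    "HOL-Analysis.Analysis"
    "HOL-Computational_Algebra.Polynomial"
    "HOL-Combinatorics.Permutations"
    "HOL-Combinatorics.Orbits"
    "HOL-Library.FuncSet"
begin

definition integer_lattice :: "(real ^ 'n) set" where
  "integer_lattice = {x. \<forall>i. x $ i \<in> \<int>}"

definition is_ehrhart_poly :: "(real ^ 'n) set \<Rightarrow> real poly \<Rightarrow> bool" where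
  "is_ehrhart_poly P f \<longleftrightarrow>
     (\<forall>t::nat. t > 0 \<longrightarrow>
        poly f (real t) = real (card ((*\<^sub>R) (real t) ` P \<inter> integer_lattice)))"

text \<open>Meaningful for polytopes with integral vertices, for which Ehrhart's theorem gives
  existence; uniqueness always holds, as shown next.\<close>

definition ehrhart_poly :: "(real ^ 'n) set \<Rightarrow> real poly" where
  "ehrhart_poly P = (THE f. is_ehrhart_poly P f)"

lemma is_ehrhart_poly_unique:
  assumes "is_ehrhart_poly P f" and "is_ehrhart_poly P g"
  shows "f = g"
proof (rule ccontr)
  assume "f \<noteq> g"
  then have "finite {x. poly (f - g) x = 0}"
    by (intro poly_roots_finite) simp
  moreover have "real ` {0<..} \<subseteq> {x. poly (f - g) x = 0}"
    using assms by (auto simp: is_ehrhart_poly_def)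
  ultimately have "finite (real ` {0<..})"
    by (rule rev_finite_subset)
  then have "finite {0::nat<..}"
    by (rule finite_imageD) (simp add: inj_on_def)
  then show False
    by (simp add: infinite_Ioi)
qed

lemma ehrhart_poly_eqI: "is_ehrhart_poly P f \<Longrightarrow> ehrhart_poly P = f"
  unfolding ehrhart_poly_def by (blast intro: is_ehrhart_poly_unique)

definition hypersimplex :: "nat \<Rightarrow> (real ^ 'n) set" where
  "hypersimplex k = {x. (\<forall>i. x $ i \<in> {0..1}) \<and> (\<Sum>i\<in>UNIV. x $ i) = real k}"

text \<open>For a fixed permutation a cycle is determined by its underlying set, so the cycles of
  \<open>\<sigma>\<close> are represented by its orbits; a fixed point \<open>i\<close> yields the orbit \<open>{i}\<close>.\<close>

definition perm_cycles :: "nat \<Rightarrow> (nat \<Rightarrow> nat) \<Rightarrow> nat set set" where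
  "perm_cycles n \<sigma> = orbit \<sigma> ` {1..n}"

definition descents :: "nat \<Rightarrow> (nat \<Rightarrow> nat) \<Rightarrow> nat set" where
  "descents r p = {i. 1 \<le> i \<and> i < r \<and> p i > p (i + 1)}"

definition des :: "nat \<Rightarrow> (nat \<Rightarrow> nat) \<Rightarrow> nat" where
  "des r p = card (descents r p)"

text \<open>A weight function on the cycles is an extensional function (\<open>undefined\<close> off the set of
  cycles), so that distinct HOL functions are distinct weights.\<close>

definition cow_perm :: "nat \<Rightarrow> (nat \<Rightarrow> nat) \<times> (nat \<Rightarrow> nat) \<times> (nat set \<Rightarrow> nat) \<Rightarrow> bool" where
  "cow_perm n = (\<lambda>(\<sigma>, p, w).
     \<sigma> permutes {1..n} \<and>
     (let r = card (perm_cycles n \<sigma>) in p permutes {1..r} \<and> p r = 1) \<and>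
     w \<in> perm_cycles n \<sigma> \<rightarrow>\<^sub>E UNIV)"

definition total_weight :: "nat \<Rightarrow> (nat \<Rightarrow> nat) \<Rightarrow> (nat set \<Rightarrow> nat) \<Rightarrow> nat" where
  "total_weight n \<sigma> w = (\<Sum>\<cc>\<in>perm_cycles n \<sigma>. w \<cc>)"

definition of_type ::
    "nat \<Rightarrow> nat \<Rightarrow> nat \<Rightarrow> (nat \<Rightarrow> nat) \<times> (nat \<Rightarrow> nat) \<times> (nat set \<Rightarrow> nat) \<Rightarrow> bool" where
  "of_type n r k = (\<lambda>(\<sigma>, p, w).
     cow_perm n (\<sigma>, p, w) \<and>
     card (perm_cycles n \<sigma>) = r \<and>
     k = total_weight n \<sigma> w + des r p)"

definition compatible ::
    "nat \<Rightarrow> (nat \<Rightarrow> nat) \<Rightarrow> (nat \<Rightarrow> nat) \<times> (nat \<Rightarrow> nat) \<times> (nat set \<Rightarrow> nat) \<Rightarrow> bool" where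
  "compatible n c = (\<lambda>(\<sigma>, p, w). \<forall>\<cc>\<in>perm_cycles n \<sigma>. w \<cc> < (\<Sum>i\<in>\<cc>. c i))"

text \<open>The triples of a given type form a finite set, so counting them never yields the default
  value \<open>0\<close> of \<open>card\<close> on infinite sets.\<close>

lemma finite_cow_perms_of_type: "finite {x. of_type n r k x}"
proof -
  let ?S = "{\<sigma>. \<sigma> permutes {1..n}}"
  have "finite (\<Union>\<sigma>\<in>?S. {\<sigma>} \<times> {p. p permutes {1..r}} \<times> (perm_cycles n \<sigma> \<rightarrow>\<^sub>E {..k}))"
    by (intro finite_UN_I finite_cartesian_product finite_permutations finite_PiE)
       (auto simp: perm_cycles_def)
  moreover have "{x. of_type n r k x} \<subseteq>
      (\<Union>\<sigma>\<in>?S. {\<sigma>} \<times> {p. p permutes {1..r}} \<times> (perm_cycles n \<sigma> \<rightarrow>\<^sub>E {..k}))"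
  proof
    fix x assume "x \<in> {x. of_type n r k x}"
    then obtain \<sigma> p w where x: "x = (\<sigma>, p, w)" and t: "of_type n r k (\<sigma>, p, w)"
      by (cases x) auto
    have "w \<cc> \<le> k" if "\<cc> \<in> perm_cycles n \<sigma>" for \<cc>
    proof -
      have "w \<cc> \<le> total_weight n \<sigma> w"
        unfolding total_weight_def using that
        by (intro member_le_sum) (auto simp: perm_cycles_def)
      then show ?thesis using t by (simp add: of_type_def)
    qed
    then show "x \<in> (\<Union>\<sigma>\<in>?S. {\<sigma>} \<times> {p. p permutes {1..r}} \<times> (perm_cycles n \<sigma> \<rightarrow>\<^sub>E {..k}))"
      using t by (auto simp: x of_type_def cow_perm_def Let_def PiE_iff)
  qed
  ultimately show ?thesis
    by (rule rev_finite_subset)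
qed

end

theory Submission
  imports Defs "HOL-Computational_Algebra.Formal_Power_Series"
begin

text \<open>
  Counting lattice points by inclusion and exclusion gives
  \<open>(n - 1)! ehr(t) = \<Sum>\<^sub>j (-1)\<^sup>j (n choose j) \<Prod>\<^sub>i ((k - j) t - j + i)\<close> with \<open>1 \<le> i < n\<close>, so the coefficient of
  \<open>t\<^sup>m\<close> is the coefficient of \<open>X\<^sup>k\<close> in the product of \<open>\<Sum>\<^sub>s s\<^sup>m X\<^sup>s\<close> and
  \<open>\<Sum>\<^sub>j (n choose j) (-X)\<^sup>j [u\<^sup>m] \<Prod>\<^sub>i (u - j + i)\<close>. The first factor is the descent generating function of
  the permutations \<open>p\<close> divided by \<open>(1 - X)\<^bsup>m+1\<^esup>\<close>. The second is the sum over the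
  permutations \<open>\<sigma>\<close> with \<open>m + 1\<close> cycles of \<open>\<Prod>\<^sub>\<cc> (1 - X\<^bsup>|\<cc>|\<^esup>)\<close>, that is, \<open>(1 - X)\<^bsup>m+1\<^esup>\<close> times the generating
  function of the compatible weights: expanding \<open>\<Prod>\<^sub>\<cc> (u - u X\<^bsup>|\<cc>|\<^esup>)\<close> colours every cycle with one of two
  colours, and the permutations with prescribed colour classes of sizes \<open>j\<close> and \<open>n - j\<close> contribute
  \<open>pochhammer (-u) j * pochhammer u (n - j) = (-1)\<^sup>j u \<Prod>\<^sub>i (u - j + i)\<close>.
\<close>

section \<open>Descents of permutations ending in 1\<close>

text \<open>Words of length \<open>r\<close> with last letter \<open>v\<close>, continued by the
  identity as for \<open>permutes\<close>. Letting the value set \<open>insert v S\<close> be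
  arbitrary keeps the family closed under deletion of the last entry.\<close>

definition orderings :: "nat \<Rightarrow> nat set \<Rightarrow> nat \<Rightarrow> (nat \<Rightarrow> nat) set" where
  "orderings r S v = {p. bij_betw p {1..r} (insert v S) \<and> p r = v \<and> (\<forall>i. i \<notin> {1..r} \<longrightarrow> p i = i)}"

text \<open>Deleting the final \<open>v\<close> exposes the previous entry \<open>b\<close>, which
  becomes the new distinguished last value and is therefore taken out of \<open>S\<close>.\<close>

lemma orderings_Suc:
  assumes "v \<notin> S" "0 < r"
  shows "orderings (Suc r) S v = (\<Union>b\<in>S. (\<lambda>q. q(Suc r := v)) ` orderings r (S - {b}) b)"
proof (intro set_eqI iffI)
  fix p assume "p \<in> orderings (Suc r) S v"
  then have p: "bij_betw p {1..Suc r} (insert v S)" "p (Suc r) = v" "\<And>i. i \<notin> {1..Suc r} \<Longrightarrow> p i = i"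
    by (auto simp: orderings_def)
  have img: "bij_betw p {1..r} S"
  proof -
    have "bij_betw p ({1..Suc r} - {Suc r}) (insert v S - {v})"
      using p(1,2) by (intro bij_betw_DiffI) auto
    moreover have "{1..Suc r} - {Suc r} = {1..r}" by auto
    ultimately show ?thesis using assms by simp
  qed
  have b: "p r \<in> S" using bij_betwE[OF img] assms by auto
  \<comment> \<open>Resetting the value at \<open>Suc r\<close> makes the shortened word the
    identity outside \<open>{1..r}\<close> again.\<close>
  have "p(Suc r := Suc r) \<in> orderings r (S - {p r}) (p r)"
  proof -
    have "bij_betw (p(Suc r := Suc r)) {1..r} S"
      using img by (rule bij_betw_cong[THEN iffD1, rotated]) auto
    moreover have "insert (p r) (S - {p r}) = S" using b by auto
    ultimately show ?thesis using p assms by (auto simp: orderings_def)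
  qed
  moreover have "p = (p(Suc r := Suc r))(Suc r := v)" using p by auto
  ultimately show "p \<in> (\<Union>b\<in>S. (\<lambda>q. q(Suc r := v)) ` orderings r (S - {b}) b)"
    using b by blast
next
  fix p assume "p \<in> (\<Union>b\<in>S. (\<lambda>q. q(Suc r := v)) ` orderings r (S - {b}) b)"
  then obtain b q where b: "b \<in> S" and q: "q \<in> orderings r (S - {b}) b" and p: "p = q(Suc r := v)"
    by auto
  have "insert b (S - {b}) = S" using b by auto
  then have "bij_betw q {1..r} S" using q by (simp add: orderings_def)
  then have "bij_betw p {1..r} S"
    by (rule bij_betw_cong[THEN iffD1, rotated]) (auto simp: p)
  then have "bij_betw p ({1..r} \<union> {Suc r}) (S \<union> {v})"
    using assms by (intro bij_betw_combine) (auto simp: p bij_betw_def)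
  moreover have "{1..r} \<union> {Suc r} = {1..Suc r}" by auto
  ultimately show "p \<in> orderings (Suc r) S v"
    using q assms by (auto simp: orderings_def p)
qed

lemma des_Suc_upd:
  assumes "0 < r"
  shows "des (Suc r) (q(Suc r := v)) = des r q + (if v < q r then 1 else 0)"
proof -
  have "descents (Suc r) (q(Suc r := v)) = descents r q \<union> (if v < q r then {r} else {})"
    using assms by (auto simp: descents_def less_Suc_eq)
  moreover have "finite (descents r q)" "r \<notin> descents r q"
    by (auto simp: descents_def)
  ultimately show ?thesis by (auto simp: des_def)
qed

lemma finite_orderings: "finite S \<Longrightarrow> finite (orderings r S v)"
proof (rule finite_subset)
  assume "finite S"
  then show "finite ((\<lambda>f i. if i \<in> {1..r} then f i else i) ` ({1..r} \<rightarrow>\<^sub>E insert v S))"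
    by (intro finite_imageI finite_PiE) auto
  show "orderings r S v \<subseteq> (\<lambda>f i. if i \<in> {1..r} then f i else i) ` ({1..r} \<rightarrow>\<^sub>E insert v S)"
  proof
    fix p assume p: "p \<in> orderings r S v"
    then have "p = (\<lambda>i. if i \<in> {1..r} then restrict p {1..r} i else i)"
      by (auto simp: orderings_def fun_eq_iff)
    moreover have "restrict p {1..r} \<in> {1..r} \<rightarrow>\<^sub>E insert v S"
      using p by (auto simp: orderings_def bij_betw_def)
    ultimately show "p \<in> (\<lambda>f i. if i \<in> {1..r} then f i else i) ` ({1..r} \<rightarrow>\<^sub>E insert v S)"
      by blast
  qed
qed

text \<open>The previous entry \<open>b\<close> separates the classes, and appending
  \<open>v\<close> creates a descent exactly when \<open>v < b\<close>, so each class contributes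
  one uniform factor.\<close>

lemma sum_orderings_Suc:
  fixes x :: "'a :: comm_semiring_1"
  assumes "finite S" "v \<notin> S" "0 < r"
  shows "(\<Sum>p\<in>orderings (Suc r) S v. x ^ des (Suc r) p) =
    (\<Sum>b\<in>S. (if v < b then x else 1) * (\<Sum>q\<in>orderings r (S - {b}) b. x ^ des r q))"
proof -
  have last: "q r = b" "q (Suc r) = Suc r" if "q \<in> orderings r T b" for q T b
    using that by (auto simp: orderings_def)
  have inj: "inj_on (\<lambda>q. q(Suc r := v)) (orderings r T b)" for T b
  proof (rule inj_onI)
    fix p q assume pq: "p \<in> orderings r T b" "q \<in> orderings r T b"
      and eq: "p(Suc r := v) = q(Suc r := v)"
    have "p i = q i" for i
      using fun_cong[OF eq, of i] pq[THEN last(2)] by (cases "i = Suc r") simp_all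
    then show "p = q" by auto
  qed
  have "(\<Sum>p\<in>orderings (Suc r) S v. x ^ des (Suc r) p) =
    (\<Sum>b\<in>S. \<Sum>p\<in>(\<lambda>q. q(Suc r := v)) ` orderings r (S - {b}) b. x ^ des (Suc r) p)"
    unfolding orderings_Suc[OF assms(2,3)]
  proof (intro sum.UNION_disjoint ballI impI finite_imageI finite_orderings)
    fix b c assume "b \<in> S" "c \<in> S" "b \<noteq> c"
    have "p r = b" if "p \<in> (\<lambda>q. q(Suc r := v)) ` orderings r (S - {b}) b" for p b
      using that by (auto dest: last(1))
    then show "(\<lambda>q. q(Suc r := v)) ` orderings r (S - {b}) b \<inter>
      (\<lambda>q. q(Suc r := v)) ` orderings r (S - {c}) c = {}"
      using \<open>b \<noteq> c\<close> by blast
  qed (use assms in auto)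
  also have "\<dots> = (\<Sum>b\<in>S. \<Sum>q\<in>orderings r (S - {b}) b. x ^ des (Suc r) (q(Suc r := v)))"
    by (simp add: sum.reindex[OF inj])
  also have "\<dots> = (\<Sum>b\<in>S. \<Sum>q\<in>orderings r (S - {b}) b. (if v < b then x else 1) * x ^ des r q)"
    using last(1) by (intro sum.cong refl) (auto simp: des_Suc_upd[OF assms(3)])
  finally show ?thesis by (simp add: sum_distrib_left)
qed

text \<open>Moving to a larger element strictly shrinks the set above it, so ranks counted from the
  top are distinct; all being below \<open>card S\<close>, they exhaust
  \<open>{..<card S}\<close>.\<close>

lemma bij_betw_card_greater:
  fixes S :: "'a :: linorder set"
  assumes "finite S"
  shows "bij_betw (\<lambda>b. card {c \<in> S. b < c}) S {..<card S}"
proof -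
  have less: "card {c \<in> S. b < c} < card {c \<in> S. a < c}" if "a < b" "b \<in> S" for a b
    using that assms by (intro psubset_card_mono) auto
  have inj: "inj_on (\<lambda>b. card {c \<in> S. b < c}) S"
  proof (rule inj_onI)
    fix a b assume "a \<in> S" "b \<in> S" "card {c \<in> S. a < c} = card {c \<in> S. b < c}"
    then show "a = b" using less[of a b] less[of b a] by (cases a b rule: linorder_cases) auto
  qed
  have "card {c \<in> S. b < c} < card S" if "b \<in> S" for b
    using that assms by (intro psubset_card_mono) auto
  then have "(\<lambda>b. card {c \<in> S. b < c}) ` S \<subseteq> {..<card S}" by auto
  then show ?thesis
    using inj by (simp add: bij_betw_def card_image card_subset_eq)
qed

text \<open>Multiplying a summand by \<open>y - x = 1\<close> turns it into the difference of the
  values of \<open>x ^ a * y ^ (N - a)\<close> at \<open>a\<close> and at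
  \<open>a + 1\<close>.\<close>

lemma sum_power_telescope:
  fixes x y :: "'a :: comm_ring_1"
  assumes "y - x = 1" "i \<le> j" "j \<le> N"
  shows "(\<Sum>a=i..<j. x ^ a * y ^ (N - 1 - a)) = x ^ i * y ^ (N - i) - x ^ j * y ^ (N - j)"
  using assms(2,3)
proof (induction j rule: dec_induct)
  case (step j)
  have e: "N - j = Suc (N - Suc j)" and e': "N - 1 - j = N - Suc j" using step by simp_all
  have "y = x + 1" using assms by (simp add: algebra_simps)
  then have "x ^ j * y ^ (N - Suc j) = x ^ j * y ^ (N - j) - x ^ Suc j * y ^ (N - Suc j)"
    unfolding e by (simp add: algebra_simps)
  then show ?case using step e' by simp
qed simp

text \<open>In degree \<open>s > 0\<close> both ranges of \<open>a\<close> telescope: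
  \<open>a \<ge> i\<close> leaves \<open>s ^ i * (s + 1) ^ (N - i) - s ^ N\<close>, while
  \<open>a < i\<close>, shifted to \<open>s - 1\<close> by the factor \<open>fps_X\<close>, leaves
  \<open>s ^ N - (s - 1) ^ i * s ^ (N - i)\<close>. The terms \<open>s ^ N\<close> cancel.\<close>

lemma sum_powers_fps:
  assumes "0 < N" "i \<le> N"
  shows "(\<Sum>a<N. (if a < i then fps_X else 1) * Abs_fps (\<lambda>s. of_nat s ^ a * of_nat (Suc s) ^ (N - 1 - a))) =
    (1 - fps_X) * Abs_fps (\<lambda>s. of_nat s ^ i * of_nat (Suc s) ^ (N - i) :: real)"
    (is "?L = ?R")
proof (rule fps_ext)
  fix s
  have split: "(\<Sum>a<N. h a) = (\<Sum>a=0..<i. h a) + (\<Sum>a=i..<N. h a)" for h :: "nat \<Rightarrow> real"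
    using assms by (simp add: sum.atLeastLessThan_concat atLeast0LessThan[symmetric])
  have "fps_nth ?L s = (\<Sum>a<N. if a < i then (if s = 0 then 0 else of_nat (s - 1) ^ a * of_nat (Suc (s - 1)) ^ (N - 1 - a))
      else of_nat s ^ a * of_nat (Suc s) ^ (N - 1 - a))"
    unfolding fps_sum_nth by (intro sum.cong refl) (auto simp del: of_nat_Suc)
  also have "\<dots> = (\<Sum>a=0..<i. if s = 0 then 0 else of_nat (s - 1) ^ a * of_nat (Suc (s - 1)) ^ (N - 1 - a))
      + (\<Sum>a=i..<N. of_nat s ^ a * of_nat (Suc s) ^ (N - 1 - a))"
    unfolding split by (intro arg_cong2[where f="(+)"] sum.cong) auto
  also have "(\<Sum>a=i..<N. of_nat s ^ a * of_nat (Suc s) ^ (N - 1 - a)) =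
      (of_nat s ^ i * of_nat (Suc s) ^ (N - i) - of_nat s ^ N :: real)"
    using assms by (subst sum_power_telescope) auto
  also have "(\<Sum>a=0..<i. if s = 0 then 0 else of_nat (s - 1) ^ a * of_nat (Suc (s - 1)) ^ (N - 1 - a)) =
      (of_nat s ^ N - (if s = 0 then 0 else of_nat (s - 1) ^ i * of_nat s ^ (N - i)) :: real)"
  proof (cases s)
    \<comment> \<open>Nothing is shifted into degree 0, and \<open>0 ^ N\<close> vanishes because
      \<open>N\<close> is positive.\<close>
    case 0 then show ?thesis using assms by simp
  next
    case (Suc u)
    have "(\<Sum>a=0..<i. of_nat u ^ a * of_nat (Suc u) ^ (N - 1 - a)) =
      (of_nat (Suc u) ^ N - of_nat u ^ i * of_nat (Suc u) ^ (N - i) :: real)"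
      using assms by (subst sum_power_telescope) auto
    then show ?thesis by (simp add: Suc del: of_nat_Suc)
  qed
  finally show "fps_nth ?L s = fps_nth ?R s"
    by (cases s) (simp_all add: left_diff_distrib del: of_nat_Suc)
qed

text \<open>Fixing the last value \<open>v\<close> and recording how many other values lie above and below it makes
  the descent generating function recursive under deletion of the last entry.\<close>

lemma sum_orderings_fps:
  assumes "finite S" "v \<notin> S"
  shows "(\<Sum>p\<in>orderings (Suc (card S)) S v. fps_X ^ des (Suc (card S)) p) =
    (1 - fps_X) ^ Suc (card S) *
    Abs_fps (\<lambda>s. of_nat s ^ card {b\<in>S. v < b} * of_nat (Suc s) ^ card {b\<in>S. b < v} :: real)"
  using assms
proof (induction "card S" arbitrary: S v)
  case 0
  then have S: "S = {}" by simp
  have "orderings (Suc 0) {} v = {id(Suc 0 := v)}"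
    by (auto simp: orderings_def bij_betw_def fun_eq_iff)
  moreover have "des (Suc 0) p = 0" for p by (simp add: des_def descents_def)
  moreover have "(1 - fps_X) * Abs_fps (\<lambda>s. 1 :: real) = 1"
    by (rule fps_ext) (auto simp: left_diff_distrib)
  ultimately show ?case by (simp add: S)
next
  case (Suc m)
  let ?N = "card S" and ?i = "card {b\<in>S. v < b}" and ?a = "\<lambda>b. card {c\<in>S. b < c}"
  let ?G = "\<lambda>a. Abs_fps (\<lambda>s. of_nat s ^ a * of_nat (Suc s) ^ (?N - 1 - a) :: real)"
  have IH: "(\<Sum>q\<in>orderings ?N (S - {b}) b. fps_X ^ des ?N q) = (1 - fps_X) ^ ?N * ?G (?a b)" if b: "b \<in> S" for b
  proof -
    have c: "card (S - {b}) = m" "?N = Suc m" using Suc b by simp_all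
    have "{c \<in> S - {b}. b < c} = {c \<in> S. b < c}" by auto
    moreover have "card (S - {b}) = ?a b + card {c \<in> S - {b}. c < b}"
      using Suc.prems by (subst card_Un_disjoint[symmetric]) (auto intro!: arg_cong[where f=card])
    then have "card {c \<in> S - {b}. c < b} = ?N - 1 - ?a b" using c by simp
    ultimately show ?thesis
      using Suc.hyps(1)[of "S - {b}" b] c Suc.prems by simp
  qed
  have pos: "0 < ?N" using Suc.hyps(2) by simp
  \<comment> \<open>The descent condition is read off from ranks, so the summand depends on
    \<open>b\<close> only through \<open>?a b\<close> and the sum over \<open>S\<close> becomes a
    sum over ranks.\<close>
  have iff: "v < b \<longleftrightarrow> ?a b < ?i" if "b \<in> S" for b
  proof
    assume "v < b" then show "?a b < ?i"
      using that Suc.prems by (intro psubset_card_mono) auto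
  next
    assume "?a b < ?i"
    moreover have "finite {c\<in>S. b < c}" using Suc.prems by simp
    ultimately have "\<not> {c\<in>S. v < c} \<subseteq> {c\<in>S. b < c}"
      using card_mono[of "{c\<in>S. b < c}" "{c\<in>S. v < c}"] by linarith
    then obtain c where "v < c" "\<not> b < c" by blast
    then show "v < b" by (meson linorder_not_less order_less_le_trans)
  qed
  have S: "S = {b\<in>S. v < b} \<union> {b\<in>S. b < v}"
    using Suc.prems by (auto, metis linorder_neqE_nat)
  have "?N = ?i + card {b\<in>S. b < v}"
    using Suc.prems by (subst S, subst card_Un_disjoint) auto
  then have below: "card {b\<in>S. b < v} = ?N - ?i" by simp
  have "(\<Sum>p\<in>orderings (Suc ?N) S v. fps_X ^ des (Suc ?N) p) =
    (\<Sum>b\<in>S. (if v < b then fps_X else 1) * ((1 - fps_X) ^ ?N * ?G (?a b)))"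
    using Suc.prems pos by (subst sum_orderings_Suc) (auto simp: IH intro!: sum.cong)
  also have "\<dots> = (1 - fps_X) ^ ?N * (\<Sum>b\<in>S. (if ?a b < ?i then fps_X else 1) * ?G (?a b))"
    by (simp add: sum_distrib_left iff mult_ac)
  also have "(\<Sum>b\<in>S. (if ?a b < ?i then fps_X else 1) * ?G (?a b)) =
      (\<Sum>a<?N. (if a < ?i then fps_X else 1) * ?G a)"
    using Suc.prems by (intro sum.reindex_bij_betw bij_betw_card_greater)
  also have "\<dots> = (1 - fps_X) * Abs_fps (\<lambda>s. of_nat s ^ ?i * of_nat (Suc s) ^ (?N - ?i) :: real)"
    using Suc.prems pos by (intro sum_powers_fps card_mono) auto
  finally show ?case by (simp add: below mult_ac)
qed

lemma permutes_last_1_eq_orderings: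
  "{p. p permutes {1..Suc m} \<and> p (Suc m) = 1} = orderings (Suc m) {2..Suc m} 1"
proof -
  have "insert 1 {2..Suc m} = {1..Suc m}" by auto
  then show ?thesis
    unfolding orderings_def
    by (auto intro: bij_imp_permutes permutes_imp_bij simp: permutes_not_in)
qed

text \<open>All \<open>m\<close> other values lie above the last value 1, so the two exponents of
  the general formula are \<open>m\<close> and 0. This is the classical Eulerian identity; for
  \<open>m = 0\<close> it relies on \<open>0 ^ 0 = 1\<close>.\<close>

lemma eulerian_fps:
  "(\<Sum>p | p permutes {1..Suc m} \<and> p (Suc m) = 1. fps_X ^ des (Suc m) p) =
    (1 - fps_X) ^ Suc m * Abs_fps (\<lambda>s. of_nat s ^ m :: real)"
proof -
  have above: "card {b \<in> {2..Suc m}. 1 < b} = m" and below: "card {b \<in> {2..Suc m}. b < 1} = 0"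
  proof -
    have "{b \<in> {2..Suc m}. 1 < b} = {2..Suc m}" by auto
    then show "card {b \<in> {2..Suc m}. 1 < b} = m" by (simp only: card_atLeastAtMost)
    have "{b \<in> {2..Suc m}. b < 1} = {}" by auto
    then show "card {b \<in> {2..Suc m}. b < 1} = 0" by (simp only: card.empty)
  qed
  have "Suc (card {2..Suc m}) = Suc m" by simp
  then show ?thesis
    using sum_orderings_fps[of "{2..Suc m}" 1, unfolded above below]
    unfolding permutes_last_1_eq_orderings by simp
qed

section \<open>Permutations with coloured cycles\<close>

lemma orbit_eq_of_mem:
  assumes "permutation f" "y \<in> orbit f x"
  shows "orbit f y = orbit f x"
  using assms by (intro orbit_cyclic_eq3 cyclic_on_orbit')

text \<open>Under \<open>\<sigma>\<close> the old preimage of \<open>b\<close> goes to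
  \<open>a\<close> and \<open>a\<close> goes to \<open>b\<close>: the new point is spliced into the
  cycle of \<open>b\<close> just before \<open>b\<close>, and all other cycles survive.\<close>

lemma orbits_transpose_comp:
  assumes \<tau>: "\<tau> permutes S" and fin: "finite S" and a: "a \<notin> S" and b: "b \<in> S"
  defines "\<sigma> \<equiv> Transposition.transpose a b \<circ> \<tau>"
  shows "orbit \<sigma> ` insert a S = insert (insert a (orbit \<tau> b)) (orbit \<tau> ` S - {orbit \<tau> b})"
proof -
  have perm\<tau>: "permutation \<tau>" using \<tau> fin by (auto simp: permutation_permutes)
  then have perm\<sigma>: "permutation \<sigma>"
    unfolding \<sigma>_def by (intro permutation_compose permutation_swap_id)
  have \<sigma>a: "\<sigma> a = b" using \<tau> a by (simp add: \<sigma>_def permutes_not_in)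
  have \<sigma>: "\<sigma> y = (if \<tau> y = b then a else \<tau> y)" if "y \<in> S" for y
  proof -
    have "\<tau> y \<in> S" using that \<tau> by (simp add: permutes_in_image)
    then show ?thesis using a by (auto simp: \<sigma>_def Transposition.transpose_def)
  qed
  have sub: "orbit \<tau> x \<subseteq> S" if "x \<in> S" for x
    using \<tau> that by (rule permutes_orbit_subset)
  have b_orbit: "b \<in> orbit \<tau> b" using perm\<tau> by (rule permutation_self_in_orbit)
  have a_orbit: "a \<in> orbit \<sigma> a" using perm\<sigma> by (rule permutation_self_in_orbit)
  have b_orbit': "b \<in> orbit \<sigma> a" using orbit.base[of \<sigma> a] \<sigma>a by simp
  have orbit_a: "orbit \<sigma> a = insert a (orbit \<tau> b)"
  proof (intro equalityI subsetI)
    fix y assume "y \<in> orbit \<sigma> a"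
    then show "y \<in> insert a (orbit \<tau> b)"
    proof induction
      case base then show ?case using b_orbit \<sigma>a by simp
    next
      case (step y)
      show ?case
      proof (cases "y = a")
        case True then show ?thesis using b_orbit \<sigma>a by simp
      next
        case False
        then have y: "y \<in> orbit \<tau> b" using step.IH by simp
        then have "y \<in> S" using sub[OF b] by auto
        then show ?thesis using \<sigma>[of y] orbit.step[OF y] by simp
      qed
    qed
  next
    \<comment> \<open>Either \<open>\<sigma>\<close> and \<open>\<tau>\<close> agree at
      \<open>y\<close>, or \<open>\<tau> y\<close> is \<open>b\<close>, which is already known to
      lie in the orbit.\<close>
    have in_orbit: "\<tau> y \<in> orbit \<sigma> a" if "y \<in> orbit \<sigma> a" "y \<in> S" for y
      using orbit.step[OF that(1)] b_orbit' \<sigma>[OF that(2)] by (auto split: if_splits)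
    fix y assume "y \<in> insert a (orbit \<tau> b)"
    moreover have "y \<in> orbit \<sigma> a" if "y \<in> orbit \<tau> b"
      using that
    proof induction
      case base then show ?case using in_orbit b b_orbit' by blast
    next
      case (step y) then show ?case using in_orbit sub[OF b] by blast
    qed
    ultimately show "y \<in> orbit \<sigma> a" using a_orbit by auto
  qed
  have same: "orbit \<sigma> x = insert a (orbit \<tau> b)" if "x \<in> orbit \<tau> b" for x
    using orbit_eq_of_mem[OF perm\<sigma>, of x a] that orbit_a by simp
  have other: "orbit \<sigma> x = orbit \<tau> x" if x: "x \<in> S" "orbit \<tau> x \<noteq> orbit \<tau> b" for x
  proof -
    \<comment> \<open>The transposition only affects values equal to \<open>b\<close>, and a cycle
      other than that of \<open>b\<close> never takes this value.\<close>
    have "b \<notin> orbit \<tau> x" using orbit_eq_of_mem[OF perm\<tau>, of b x] x by auto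
    then have "\<tau> y = \<sigma> y" if "y \<in> orbit \<tau> x" for y
      using \<sigma>[of y] sub[OF x(1)] that orbit.step[OF that] by auto
    then show ?thesis
      using permutation_self_in_orbit[OF perm\<tau>]
      by (intro orbit_cong0[of x "orbit \<tau> x", symmetric]) (auto intro: orbit.step)
  qed
  have mem: "x \<in> orbit \<tau> b" if "orbit \<tau> x = orbit \<tau> b" for x
    using permutation_self_in_orbit[OF perm\<tau>, of x] that by simp
  show ?thesis
  proof (intro equalityI subsetI)
    fix c assume "c \<in> orbit \<sigma> ` insert a S"
    then obtain x where "x = a \<or> x \<in> S" and c: "c = orbit \<sigma> x" by blast
    then consider "x = a" | "x \<in> orbit \<tau> b" | "x \<in> S" "orbit \<tau> x \<noteq> orbit \<tau> b"
      using mem by blast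
    then show "c \<in> insert (insert a (orbit \<tau> b)) (orbit \<tau> ` S - {orbit \<tau> b})"
      by cases (simp_all add: c orbit_a same other)
  next
    fix c assume "c \<in> insert (insert a (orbit \<tau> b)) (orbit \<tau> ` S - {orbit \<tau> b})"
    then consider "c = orbit \<sigma> a" | x where "x \<in> S" "c = orbit \<tau> x" "c \<noteq> orbit \<tau> b"
      using orbit_a by blast
    then show "c \<in> orbit \<sigma> ` insert a S"
    proof cases
      case (2 x)
      then have "c = orbit \<sigma> x" using other by simp
      then show ?thesis using \<open>x \<in> S\<close> by blast
    qed simp
  qed
qed

lemma orbits_fixed_point:
  assumes "\<tau> permutes S" "a \<notin> S"
  shows "orbit \<tau> ` insert a S = insert {a} (orbit \<tau> ` S)"
proof -
  have "orbit \<tau> a = {a}" using assms by (simp add: orbit_eq_singleton_iff permutes_not_in)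
  then show ?thesis by simp
qed

text \<open>\<open>A\<close> is the set of points of the first colour, and cycles of mixed colour
  get weight 0. Colourings of cycles thereby become colourings of points, which can be fixed before
  the permutation is chosen.\<close>

definition cycle_colour :: "'b \<Rightarrow> 'b \<Rightarrow> 'a set \<Rightarrow> 'a set \<Rightarrow> 'b :: comm_semiring_1" where
  "cycle_colour \<alpha> \<beta> A c = (if c \<subseteq> A then \<alpha> else if c \<inter> A = {} then \<beta> else 0)"

lemma cycle_colour_insert:
  assumes "b \<in> c"
  shows "cycle_colour \<alpha> \<beta> A (insert a c) = (if a \<in> A \<longleftrightarrow> b \<in> A then cycle_colour \<alpha> \<beta> A c else 0)"
  using assms by (auto simp: cycle_colour_def)

text \<open>Permutations are built point by point. A new point either forms its own cycle, with
  weight \<open>\<alpha>\<close> or \<open>\<beta>\<close>, or is spliced in before an old point,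
  which must have the same colour. The resulting factor, \<open>\<alpha>\<close> or
  \<open>\<beta>\<close> plus the number of old points of that colour, is the next Pochhammer
  factor.\<close>

lemma sum_permutes_cycle_colour:
  fixes \<alpha> \<beta> :: "'b :: comm_semiring_1"
  assumes "finite S"
  shows "(\<Sum>\<sigma> | \<sigma> permutes S. \<Prod>c\<in>orbit \<sigma> ` S. cycle_colour \<alpha> \<beta> A c) =
    pochhammer \<alpha> (card (S \<inter> A)) * pochhammer \<beta> (card (S - A))"
  using assms
proof (induction S)
  case empty
  then show ?case by simp
next
  case (insert a S)
  let ?g = "cycle_colour \<alpha> \<beta> A"
  let ?F = "\<Sum>\<sigma> | \<sigma> permutes S. \<Prod>c\<in>orbit \<sigma> ` S. ?g c"
  \<comment> \<open>\<open>transpose a a\<close> is the identity; this form matches the term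
    \<open>b = a\<close> in the decomposition of a permutation of \<open>insert a S\<close> as
    \<open>transpose a b \<circ> \<tau>\<close>.\<close>
  have fixed: "(\<Sum>\<tau> | \<tau> permutes S. \<Prod>c\<in>orbit (Transposition.transpose a a \<circ> \<tau>) ` insert a S. ?g c) =
    (if a \<in> A then \<alpha> else \<beta>) * ?F"
  proof -
    have "(\<Prod>c\<in>orbit (Transposition.transpose a a \<circ> \<tau>) ` insert a S. ?g c) = ?g {a} * (\<Prod>c\<in>orbit \<tau> ` S. ?g c)"
      if \<tau>: "\<tau> permutes S" for \<tau>
    proof -
      have "{a} \<notin> orbit \<tau> ` S" using permutes_orbit_subset[OF \<tau>] insert.hyps by blast
      then show ?thesis
        using insert.hyps orbits_fixed_point[OF \<tau>] by (simp del: image_insert)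
    qed
    then show ?thesis by (simp add: sum_distrib_left cycle_colour_def)
  qed
  have merged: "(\<Sum>\<tau> | \<tau> permutes S. \<Prod>c\<in>orbit (Transposition.transpose a b \<circ> \<tau>) ` insert a S. ?g c) =
    (if a \<in> A \<longleftrightarrow> b \<in> A then ?F else 0)" if b: "b \<in> S" for b
  proof -
    have "(\<Prod>c\<in>orbit (Transposition.transpose a b \<circ> \<tau>) ` insert a S. ?g c) =
      (if a \<in> A \<longleftrightarrow> b \<in> A then \<Prod>c\<in>orbit \<tau> ` S. ?g c else 0)" if \<tau>: "\<tau> permutes S" for \<tau>
    proof -
      have "permutation \<tau>" using \<tau> insert.hyps by (auto simp: permutation_permutes)
      then have "b \<in> orbit \<tau> b" by (rule permutation_self_in_orbit)
      then have g: "?g (insert a (orbit \<tau> b)) = (if a \<in> A \<longleftrightarrow> b \<in> A then ?g (orbit \<tau> b) else 0)"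
        by (rule cycle_colour_insert)
      \<comment> \<open>The enlarged cycle contains \<open>a\<close>, unlike every cycle of
        \<open>\<tau>\<close> on \<open>S\<close>, so its factor splits off the product.\<close>
      have "insert a (orbit \<tau> b) \<notin> orbit \<tau> ` S"
        using permutes_orbit_subset[OF \<tau>] insert.hyps by blast
      then have "(\<Prod>c\<in>orbit (Transposition.transpose a b \<circ> \<tau>) ` insert a S. ?g c) =
        ?g (insert a (orbit \<tau> b)) * (\<Prod>c\<in>orbit \<tau> ` S - {orbit \<tau> b}. ?g c)"
        using insert.hyps b by (subst orbits_transpose_comp[OF \<tau>]) auto
      moreover have "(\<Prod>c\<in>orbit \<tau> ` S. ?g c) = ?g (orbit \<tau> b) * (\<Prod>c\<in>orbit \<tau> ` S - {orbit \<tau> b}. ?g c)"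
        using insert.hyps b by (intro prod.remove) auto
      ultimately show ?thesis using g by auto
    qed
    then show ?thesis by simp
  qed
  have "(\<Sum>\<sigma> | \<sigma> permutes insert a S. \<Prod>c\<in>orbit \<sigma> ` insert a S. ?g c) =
    (if a \<in> A then \<alpha> else \<beta>) * ?F + (\<Sum>b\<in>S. if a \<in> A \<longleftrightarrow> b \<in> A then ?F else 0)"
    unfolding sum_over_permutations_insert[OF insert.hyps]
    unfolding sum.insert[OF insert.hyps] fixed
    by (intro arg_cong2[where f="(+)"] sum.cong refl merged)
  also have "(\<Sum>b\<in>S. if a \<in> A \<longleftrightarrow> b \<in> A then ?F else 0) =
    of_nat (card {b\<in>S. a \<in> A \<longleftrightarrow> b \<in> A}) * ?F"
    using insert.hyps by (simp add: sum.inter_filter[symmetric])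
  also have "{b\<in>S. a \<in> A \<longleftrightarrow> b \<in> A} = (if a \<in> A then S \<inter> A else S - A)" by auto
  finally show ?case
    using insert.hyps
    by (auto simp: insert.IH pochhammer_Suc insert_Diff_if Int_insert_left algebra_simps)
qed

text \<open>Only unions of blocks contribute, and such a union corresponds to the subset
  \<open>X\<close> of blocks it consists of. Choosing \<open>X\<close> is choosing one of the two
  summands in every factor on the right.\<close>

lemma sum_power_cycle_colour:
  fixes x \<alpha> \<beta> :: "'b :: comm_semiring_1"
  assumes fin: "finite S" and C: "\<Union>C = S" "pairwise disjnt C" "{} \<notin> C"
  shows "(\<Sum>A\<in>Pow S. x ^ card A * (\<Prod>c\<in>C. cycle_colour \<alpha> \<beta> A c)) =
    (\<Prod>c\<in>C. \<alpha> * x ^ card c + \<beta>)"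
proof -
  let ?g = "cycle_colour \<alpha> \<beta>"
  have finC: "finite C" using fin C(1) by (metis finite_UnionD)
  have finc: "finite c" if "c \<in> C" for c using that fin C(1) by (metis Union_upper finite_subset)
  have disj: "c \<inter> d = {}" if "c \<in> C" "d \<in> C" "c \<noteq> d" for c d
    using C(2) that by (auto simp: pairwise_def disjnt_def)
  have sub: "c \<subseteq> \<Union>X \<longleftrightarrow> c \<in> X" "c \<inter> \<Union>X = {} \<longleftrightarrow> c \<notin> X" if "X \<subseteq> C" "c \<in> C" for X c
  proof -
    have "c \<noteq> {}" using C(3) that by auto
    have "c \<inter> \<Union>X = {}" if "c \<notin> X"
      using that disj[OF \<open>c \<in> C\<close>] \<open>X \<subseteq> C\<close> by blast
    then show "c \<subseteq> \<Union>X \<longleftrightarrow> c \<in> X" "c \<inter> \<Union>X = {} \<longleftrightarrow> c \<notin> X"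
      using \<open>c \<noteq> {}\<close> by blast+
  qed
  have inj: "inj_on Union (Pow C)"
  proof (rule inj_onI)
    fix X Y assume "X \<in> Pow C" "Y \<in> Pow C" "\<Union>X = \<Union>Y"
    then show "X = Y" using sub(1) by (metis PowD subsetD subsetI subset_antisym)
  qed
  have "(\<Sum>A\<in>Pow S. x ^ card A * (\<Prod>c\<in>C. ?g A c)) =
    (\<Sum>A\<in>Union ` Pow C. x ^ card A * (\<Prod>c\<in>C. ?g A c))"
  proof (rule sum.mono_neutral_right)
    show "\<forall>A\<in>Pow S - Union ` Pow C. x ^ card A * (\<Prod>c\<in>C. ?g A c) = 0"
    proof
      fix A assume A: "A \<in> Pow S - Union ` Pow C"
      have "\<exists>c\<in>C. \<not> c \<subseteq> A \<and> c \<inter> A \<noteq> {}"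
      proof (rule ccontr)
        assume "\<not> ?thesis"
        then have "A = \<Union>{c\<in>C. c \<subseteq> A}" using A C(1) by blast
        then show False using A by blast
      qed
      then have "\<exists>c\<in>C. ?g A c = 0" by (auto simp: cycle_colour_def)
      with finC have "(\<Prod>c\<in>C. ?g A c) = 0" by (rule prod_zero)
      then show "x ^ card A * (\<Prod>c\<in>C. ?g A c) = 0" by simp
    qed
  qed (use fin C in auto)
  also have "\<dots> = (\<Sum>X\<in>Pow C. x ^ card (\<Union>X) * (\<Prod>c\<in>C. ?g (\<Union>X) c))"
    using inj by (simp add: sum.reindex)
  also have "\<dots> = (\<Sum>X\<in>Pow C. (\<Prod>c\<in>X. \<alpha> * x ^ card c) * (\<Prod>c\<in>C - X. \<beta>))"
  proof (rule sum.cong[OF refl])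
    fix X assume "X \<in> Pow C"
    then have X: "X \<subseteq> C" by simp
    have "card (\<Union>X) = (\<Sum>c\<in>X. card c)"
      using X finc by (intro card_Union_disjoint pairwise_subset[OF C(2)]) auto
    then have "x ^ card (\<Union>X) = (\<Prod>c\<in>X. x ^ card c)" by (simp add: power_sum)
    moreover have "(\<Prod>c\<in>C. ?g (\<Union>X) c) = (\<Prod>c\<in>C - X. \<beta>) * (\<Prod>c\<in>X. \<alpha>)"
      unfolding prod.subset_diff[OF X finC]
      using X sub by (intro arg_cong2[where f="(*)"] prod.cong) (auto simp: cycle_colour_def subset_iff)
    ultimately show "x ^ card (\<Union>X) * (\<Prod>c\<in>C. ?g (\<Union>X) c) =
      (\<Prod>c\<in>X. \<alpha> * x ^ card c) * (\<Prod>c\<in>C - X. \<beta>)"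
      by (simp add: prod.distrib mult_ac)
  qed
  also have "\<dots> = (\<Prod>c\<in>C. \<alpha> * x ^ card c + \<beta>)" using finC by (simp only: prod_add)
  finally show ?thesis .
qed

lemma orbit_partition:
  assumes "\<sigma> permutes S" "finite S"
  shows "\<Union>(orbit \<sigma> ` S) = S" "pairwise disjnt (orbit \<sigma> ` S)" "{} \<notin> orbit \<sigma> ` S"
proof -
  have perm: "permutation \<sigma>" using assms by (auto simp: permutation_permutes)
  show "\<Union>(orbit \<sigma> ` S) = S"
    using permutes_orbit_subset[OF assms(1)] permutation_self_in_orbit[OF perm] by blast
  show "pairwise disjnt (orbit \<sigma> ` S)"
    unfolding pairwise_def disjnt_def using orbit_eq_of_mem[OF perm] by blast
  show "{} \<notin> orbit \<sigma> ` S" using permutation_self_in_orbit[OF perm] by blast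
qed

lemma sum_Pow_card:
  assumes "finite S"
  shows "(\<Sum>A\<in>Pow S. f (card A)) = (\<Sum>j\<le>card S. of_nat (card S choose j) * (f j :: 'a :: comm_semiring_1))"
proof -
  have "(\<Sum>A\<in>Pow S. f (card A)) = (\<Sum>j\<le>card S. \<Sum>A | A \<in> Pow S \<and> card A = j. f (card A))"
    using assms by (intro sum.group[symmetric]) (auto intro: card_mono)
  also have "\<dots> = (\<Sum>j\<le>card S. of_nat (card S choose j) * f j)"
    using assms by (intro sum.cong refl) (simp add: n_subsets)
  finally show ?thesis .
qed

text \<open>Up to sign the factors are the runs from \<open>u - j + 1\<close> to \<open>u\<close>
  and from \<open>u\<close> to \<open>u + n - j - 1\<close>. Pulling out the repeated
  \<open>u\<close> leaves a single run of \<open>n - 1\<close> consecutive factors.\<close>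

lemma pochhammer_minus_mult:
  fixes u :: "'a :: comm_ring_1"
  assumes "0 < n" "j \<le> n"
  shows "pochhammer (- u) j * pochhammer u (n - j) = (-1) ^ j * (u * pochhammer (u + 1 - of_nat j) (n - 1))"
proof (cases j)
  \<comment> \<open>Here the first run is empty and the extracted \<open>u\<close> is the leading
    factor of the second.\<close>
  case 0
  then show ?thesis using assms pochhammer_rec[of u "n - 1"] by simp
next
  case (Suc i)
  have "u + 1 - of_nat j + of_nat i = u" by (simp add: Suc)
  then have "pochhammer (u + 1 - of_nat j) (n - 1) = pochhammer (u + 1 - of_nat j) i * pochhammer u (n - j)"
    using assms pochhammer_product[of i "n - 1" "u + 1 - of_nat j"] Suc by simp
  moreover have "pochhammer (u - of_nat j + 1) j = pochhammer (u + 1 - of_nat j) i * u"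
    using \<open>u + 1 - of_nat j + of_nat i = u\<close> pochhammer_Suc[of "u + 1 - of_nat j" i]
    by (simp add: Suc algebra_simps)
  ultimately show ?thesis by (simp add: pochhammer_minus mult_ac)
qed

lemma sum_permutes_cycles:
  fixes x u :: "'b :: comm_ring_1"
  assumes "finite S" "S \<noteq> {}"
  shows "(\<Sum>\<sigma> | \<sigma> permutes S. \<Prod>c\<in>orbit \<sigma> ` S. u * (1 - x ^ card c)) =
    (\<Sum>j\<le>card S. of_nat (card S choose j) * ((- x) ^ j * (u * pochhammer (u + 1 - of_nat j) (card S - 1))))"
proof -
  have "(\<Sum>\<sigma> | \<sigma> permutes S. \<Prod>c\<in>orbit \<sigma> ` S. u * (1 - x ^ card c)) =
    (\<Sum>\<sigma> | \<sigma> permutes S. \<Sum>A\<in>Pow S. x ^ card A * (\<Prod>c\<in>orbit \<sigma> ` S. cycle_colour (- u) u A c))"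
    using assms by (intro sum.cong refl) (simp add: sum_power_cycle_colour orbit_partition algebra_simps)
  \<comment> \<open>With the colouring fixed first, the sum over permutations depends only on
    \<open>card A\<close>.\<close>
  also have "\<dots> = (\<Sum>A\<in>Pow S. x ^ card A * (\<Sum>\<sigma> | \<sigma> permutes S. \<Prod>c\<in>orbit \<sigma> ` S. cycle_colour (- u) u A c))"
    by (subst sum.swap) (simp add: sum_distrib_left)
  also have "\<dots> = (\<Sum>A\<in>Pow S. x ^ card A * (pochhammer (- u) (card A) * pochhammer u (card S - card A)))"
    using assms by (intro sum.cong refl)
      (auto simp: sum_permutes_cycle_colour Int_absorb1 card_Diff_subset finite_subset)
  also have "\<dots> = (\<Sum>j\<le>card S. of_nat (card S choose j) * (x ^ j * (pochhammer (- u) j * pochhammer u (card S - j))))"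
    using assms(1) by (rule sum_Pow_card)
  also have "\<dots> = (\<Sum>j\<le>card S. of_nat (card S choose j) * ((- x) ^ j * (u * pochhammer (u + 1 - of_nat j) (card S - 1))))"
    using assms by (intro sum.cong refl) (simp add: pochhammer_minus_mult card_gt_0_iff power_minus[of x] mult_ac)
  finally show ?thesis .
qed

text \<open>Taking \<open>u\<close> to be a polynomial variable and \<open>x\<close> a constant
  polynomial, the exponent of \<open>u\<close> counts cycles. The separate factor \<open>u\<close>
  lowers the degree to be read off from \<open>Suc m\<close> to \<open>m\<close>.\<close>

lemma sum_permutes_fixed_cycles:
  fixes x :: "'b :: comm_ring_1"
  assumes "finite S" "S \<noteq> {}"
  shows "(\<Sum>\<sigma> | \<sigma> permutes S \<and> card (orbit \<sigma> ` S) = Suc m. \<Prod>c\<in>orbit \<sigma> ` S. 1 - x ^ card c) =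
    (\<Sum>j\<le>card S. of_nat (card S choose j) * ((- x) ^ j * coeff (pochhammer [:1 - of_nat j, 1:] (card S - 1)) m))"
proof -
  let ?X = "[:x:]" and ?u = "[:0, 1:] :: 'b poly"
  let ?w = "\<lambda>\<sigma>. \<Prod>c\<in>orbit \<sigma> ` S. 1 - x ^ card c"
  have const: "(\<Prod>c\<in>C. 1 - ?X ^ card c) = [:\<Prod>c\<in>C. 1 - x ^ card c:]" for C :: "'a set set"
    by (simp add: prod_to_poly poly_const_pow one_pCons)
  have "(\<Sum>\<sigma> | \<sigma> permutes S. monom (?w \<sigma>) (card (orbit \<sigma> ` S))) =
    (\<Sum>\<sigma> | \<sigma> permutes S. \<Prod>c\<in>orbit \<sigma> ` S. ?u * (1 - ?X ^ card c))"
    unfolding prod.distrib const by (intro sum.cong refl) (simp add: monom_altdef mult.commute)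
  also have "\<dots> = (\<Sum>j\<le>card S. of_nat (card S choose j) * ((- ?X) ^ j * (?u * pochhammer (?u + 1 - of_nat j) (card S - 1))))"
    using assms by (rule sum_permutes_cycles)
  also have "\<dots> = (\<Sum>j\<le>card S. smult (of_nat (card S choose j) * (- x) ^ j)
      (pCons 0 (pochhammer [:1 - of_nat j, 1:] (card S - 1))))"
    by (intro sum.cong refl) (simp add: of_nat_poly poly_const_pow one_pCons mult.commute)
  finally have "coeff (\<Sum>\<sigma> | \<sigma> permutes S. monom (?w \<sigma>) (card (orbit \<sigma> ` S))) (Suc m) =
    coeff (\<Sum>j\<le>card S. smult (of_nat (card S choose j) * (- x) ^ j)
      (pCons 0 (pochhammer [:1 - of_nat j, 1:] (card S - 1)))) (Suc m)" by simp
  moreover have "(\<Sum>\<sigma> | \<sigma> permutes S \<and> card (orbit \<sigma> ` S) = Suc m. ?w \<sigma>) =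
    (\<Sum>\<sigma> | \<sigma> permutes S. if card (orbit \<sigma> ` S) = Suc m then ?w \<sigma> else 0)"
    using finite_permutations[OF assms(1)] by (simp add: sum.inter_filter[symmetric])
  ultimately show ?thesis by (simp add: coeff_sum mult_ac)
qed

section \<open>Lattice points of dilated hypersimplices\<close>

lemma scaleR_image_hypersimplex:
  assumes "0 < t"
  shows "(*\<^sub>R) (real t) ` (hypersimplex k :: (real ^ 'n) set) =
    {x. (\<forall>i. 0 \<le> x $ i \<and> x $ i \<le> real t) \<and> (\<Sum>i\<in>UNIV. x $ i) = real (k * t)}"
proof (intro equalityI subsetI)
  fix x assume "x \<in> (*\<^sub>R) (real t) ` (hypersimplex k :: (real ^ 'n) set)"
  then obtain y where y: "y \<in> hypersimplex k" "x = real t *\<^sub>R y" by auto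
  then show "x \<in> {x. (\<forall>i. 0 \<le> x $ i \<and> x $ i \<le> real t) \<and> (\<Sum>i\<in>UNIV. x $ i) = real (k * t)}"
    by (auto simp: hypersimplex_def sum_distrib_left[symmetric] mult_left_le)
next
  fix x :: "real ^ 'n"
  assume x: "x \<in> {x. (\<forall>i. 0 \<le> x $ i \<and> x $ i \<le> real t) \<and> (\<Sum>i\<in>UNIV. x $ i) = real (k * t)}"
  have "(1 / real t) *\<^sub>R x \<in> hypersimplex k"
    using x assms by (auto simp: hypersimplex_def sum_divide_distrib[symmetric])
  moreover have "x = real t *\<^sub>R ((1 / real t) *\<^sub>R x)" using assms by simp
  ultimately show "x \<in> (*\<^sub>R) (real t) ` (hypersimplex k :: (real ^ 'n) set)" by blast
qed

lemma fps_nth_sum_X_power: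
  assumes "finite T"
  shows "fps_nth (\<Sum>x\<in>T. fps_X ^ h x) k = (of_nat (card {x\<in>T. h x = k}) :: 'a :: comm_ring_1)"
  using assms by (simp add: fps_sum_nth sum.inter_filter[symmetric] eq_commute)

text \<open>A lattice point of the dilate picks an integer from 0 to \<open>t\<close> for each
  coordinate with total \<open>k * t\<close>, so each coordinate contributes one truncated geometric
  series.\<close>

lemma card_lattice_points_hypersimplex:
  assumes "0 < t"
  shows "real (card ((*\<^sub>R) (real t) ` (hypersimplex k :: (real ^ 'n) set) \<inter> integer_lattice)) =
    fps_nth ((\<Sum>i<Suc t. fps_X ^ i) ^ CARD('n)) (k * t)"
proof -
  let ?T = "PiE (UNIV :: 'n set) (\<lambda>_. {..<Suc t})"
  let ?h = "\<lambda>f :: 'n \<Rightarrow> nat. \<Sum>i\<in>UNIV. f i"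
  have "(*\<^sub>R) (real t) ` (hypersimplex k :: (real ^ 'n) set) \<inter> integer_lattice =
    (\<lambda>f. \<chi> i. real (f i)) ` {f\<in>?T. ?h f = k * t}" (is "?L = ?R")
  proof (intro equalityI subsetI)
    fix x assume x: "x \<in> ?L"
    have nat: "real (nat \<lfloor>x $ i\<rfloor>) = x $ i" and le: "x $ i \<le> real t" for i
    proof -
      have "x $ i \<in> \<int>" "0 \<le> x $ i"
        using x unfolding scaleR_image_hypersimplex[OF assms] by (auto simp: integer_lattice_def)
      then show "real (nat \<lfloor>x $ i\<rfloor>) = x $ i" by (auto elim!: Ints_cases)
      show "x $ i \<le> real t" using x unfolding scaleR_image_hypersimplex[OF assms] by auto
    qed
    let ?f = "\<lambda>i. nat \<lfloor>x $ i\<rfloor>"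
    have "real (?h ?f) = real (k * t)"
      using x unfolding scaleR_image_hypersimplex[OF assms] by (simp add: nat)
    then have "?h ?f = k * t" by (simp only: of_nat_eq_iff)
    moreover have "?f i < Suc t" for i
    proof -
      have "real (?f i) \<le> real t" unfolding nat by (rule le)
      then show ?thesis by (simp only: of_nat_le_iff less_Suc_eq_le)
    qed
    moreover have "x = (\<chi> i. real (?f i))" by (simp add: nat vec_eq_iff)
    ultimately show "x \<in> ?R" by (intro image_eqI[of _ _ ?f]) auto
  next
    fix x assume "x \<in> ?R"
    then obtain f where f: "x = (\<chi> i. real (f i))" "\<And>i. f i < Suc t" "?h f = k * t" by auto
    have "(\<Sum>i\<in>UNIV. real (f i)) = real (k * t)" using f(3) by (simp only: of_nat_sum[symmetric])
    moreover have "real (f i) \<le> real t" for i using f(2)[of i] by simp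
    ultimately show "x \<in> ?L"
      unfolding scaleR_image_hypersimplex[OF assms] f(1) integer_lattice_def by simp
  qed
  moreover have "inj_on (\<lambda>f. (\<chi> i. real (f i)) :: real ^ 'n) {f\<in>?T. ?h f = k * t}"
    by (rule inj_onI) (auto simp: vec_eq_iff)
  ultimately have "real (card ((*\<^sub>R) (real t) ` (hypersimplex k :: (real ^ 'n) set) \<inter> integer_lattice)) =
    real (card {f\<in>?T. ?h f = k * t})"
    by (simp only: card_image)
  also have "\<dots> = fps_nth (\<Sum>f\<in>?T. fps_X ^ ?h f) (k * t)"
    by (intro fps_nth_sum_X_power[symmetric] finite_PiE) auto
  also have "(\<Sum>f\<in>?T. fps_X ^ ?h f) = (\<Prod>i\<in>(UNIV :: 'n set). \<Sum>j<Suc t. fps_X ^ j :: real fps)"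
    by (subst prod_sum_PiE) (auto simp: power_sum)
  finally show ?thesis by simp
qed

text \<open>Each factor is \<open>(1 - fps_X ^ Suc t) / (1 - fps_X)\<close>: the binomial theorem
  expands the numerator and the negative binomial series the denominator. The guard excludes
  negative exponents, for which truncated subtraction would turn the binomial coefficient into
  1.\<close>

lemma fps_nth_geometric_sum_power:
  fixes n :: nat
  assumes "0 < n"
  shows "fps_nth ((\<Sum>i<Suc t. fps_X ^ i) ^ n :: real fps) K =
    (\<Sum>j\<le>n. (-1) ^ j * real (n choose j) *
      (if j * Suc t \<le> K then real ((n + (K - j * Suc t) - 1) choose (K - j * Suc t)) else 0))"
proof -
  let ?N = "Abs_fps (\<lambda>k. real ((n + k - 1) choose k))"
  have inv: "inverse ((1 - fps_X) ^ n) = ?N"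
    using one_minus_const_fps_X_neg_power'[OF assms, of "1 :: real"] by simp
  have ge: "(1 - fps_X) * (\<Sum>i<Suc t. fps_X ^ i) = (1 - fps_X ^ Suc t :: real fps)"
    by (simp only: one_diff_power_eq)
  have D: "inverse ((1 - fps_X) ^ n) * (1 - fps_X) ^ n = (1 :: real fps)"
    by (rule inverse_mult_eq_1) (simp add: fps_nth_power_0)
  have "(\<Sum>i<Suc t. fps_X ^ i) ^ n =
    (inverse ((1 - fps_X) ^ n) * (1 - fps_X) ^ n) * (\<Sum>i<Suc t. fps_X ^ i :: real fps) ^ n"
    unfolding D by simp
  also have "\<dots> = ((1 - fps_X) ^ n * (\<Sum>i<Suc t. fps_X ^ i) ^ n) * inverse ((1 - fps_X) ^ n)"
    by (simp only: mult_ac)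
  also have "(1 - fps_X) ^ n * (\<Sum>i<Suc t. fps_X ^ i) ^ n = (1 - fps_X ^ Suc t :: real fps) ^ n"
    by (simp only: power_mult_distrib[symmetric] ge)
  also have "(1 - fps_X ^ Suc t :: real fps) ^ n = (- (fps_X ^ Suc t) + 1) ^ n" by simp
  also have "\<dots> = (\<Sum>j\<le>n. fps_const ((-1) ^ j * real (n choose j)) * fps_X ^ (j * Suc t))"
  proof -
    have "of_nat (n choose j) * (- (fps_X ^ Suc t)) ^ j * 1 ^ (n - j) =
      fps_const ((-1) ^ j * real (n choose j)) * (fps_X ^ (j * Suc t) :: real fps)" for j
    proof -
      have "(- (fps_X ^ Suc t :: real fps)) ^ j = (-1) ^ j * fps_X ^ (j * Suc t)"
        by (subst power_minus) (simp only: power_mult[symmetric] mult.commute)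
      moreover have "fps_const ((-1) ^ j * real (n choose j)) = (-1) ^ j * (of_nat (n choose j) :: real fps)"
        by (simp add: fps_of_nat[symmetric] fps_const_mult[symmetric] fps_const_power[symmetric] fps_const_neg[symmetric] del: fps_const_mult fps_const_power fps_const_neg)
      ultimately show ?thesis by (simp only: mult_ac power_one mult_1_left)
    qed
    then show ?thesis unfolding binomial_ring by simp
  qed
  finally have "(\<Sum>i<Suc t. fps_X ^ i) ^ n =
    (\<Sum>j\<le>n. fps_const ((-1) ^ j * real (n choose j)) * (fps_X ^ (j * Suc t) * ?N))"
    by (simp only: inv sum_distrib_right mult.assoc)
  then show ?thesis
    by (auto simp: fps_sum_nth fps_X_power_mult_nth intro!: sum.cong)
qed

lemma poly_pochhammer: "poly (pochhammer p n) x = pochhammer (poly p x) n"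
  by (induction n) (simp_all add: pochhammer_Suc)

text \<open>The inclusion-exclusion sum of \<open>(-1) ^ j * (n choose j)\<close> times the binomial
  coefficient of \<open>(k - j) * t - j + n - 1\<close> over \<open>n - 1\<close>. Keeping a
  polynomial in \<open>u\<close> and substituting \<open>u = (k - j) * t\<close> afterwards makes
  its coefficients scale by powers of \<open>k - j\<close>.\<close>

definition hypersimplex_ehrhart :: "nat \<Rightarrow> nat \<Rightarrow> real poly" where
  "hypersimplex_ehrhart k n = (\<Sum>j\<le>k. smult ((-1) ^ j * real (n choose j) / fact (n - 1))
     (pochhammer [:1 - of_nat j, 1:] (n - 1) \<circ>\<^sub>p [:0, of_nat (k - j):]))"

lemma is_ehrhart_poly_hypersimplex:
  assumes "k < CARD('n)"
  shows "is_ehrhart_poly (hypersimplex k :: (real ^ 'n) set) (hypersimplex_ehrhart k CARD('n))"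
  unfolding is_ehrhart_poly_def
proof (intro allI impI)
  fix t :: nat assume t: "0 < t"
  let ?n = "CARD('n)"
  let ?b = "\<lambda>j. if j * Suc t \<le> k * t
    then real ((?n + (k * t - j * Suc t) - 1) choose (k * t - j * Suc t)) else 0"
  \<comment> \<open>The Pochhammer quotient must agree with the guarded binomial coefficient, also
    where the guard fails and the count is 0.\<close>
  have summand: "pochhammer (1 - real j + real (k - j) * real t) (?n - 1) / fact (?n - 1) = ?b j"
    if j: "j \<le> k" for j
  proof (cases "j * Suc t \<le> k * t")
    case True
    define N where "N = k * t - j * Suc t"
    have "real N = real k * real t - real j * (real t + 1)"
      using True by (simp add: N_def of_nat_diff algebra_simps)
    then have "1 - real j + real (k - j) * real t = real N + 1"
      using j by (simp add: of_nat_diff algebra_simps)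
    also have "\<dots> = real (N + (?n - 1)) - real (?n - 1) + 1" by (simp only: of_nat_add)
    finally have arg: "1 - real j + real (k - j) * real t = real (N + (?n - 1)) - real (?n - 1) + 1" .
    have "pochhammer (1 - real j + real (k - j) * real t) (?n - 1) / fact (?n - 1) =
      real (N + (?n - 1) choose (?n - 1))"
      unfolding arg binomial_gbinomial gbinomial_pochhammer' ..
    also have "N + (?n - 1) choose (?n - 1) = (?n + N - 1 choose N)"
      using assms binomial_symmetric[of N "N + (?n - 1)"] by (simp add: add.commute)
    finally show ?thesis using True by (simp add: N_def)
  next
    case False
    \<comment> \<open>The Pochhammer product starts at \<open>- M\<close>. Since
      \<open>j * t \<le> k * t\<close>, \<open>M\<close> is at most \<open>j - 1\<close>, hence
      below \<open>n - 1\<close>, and the product runs through 0.\<close>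
    define M where "M = j * Suc t - k * t - 1"
    have "M < ?n - 1"
      using mult_le_mono1[OF j, of t] False j assms unfolding M_def mult_Suc_right by linarith
    have "M + 1 + k * t = j * Suc t" using False by (simp add: M_def)
    then have "real M + 1 + real k * real t = real j * (1 + real t)"
      by (metis of_nat_1 of_nat_Suc of_nat_add of_nat_mult)
    then have arg: "1 - real j + real (k - j) * real t = - real M"
      using j by (simp add: of_nat_diff algebra_simps)
    show ?thesis
      unfolding arg using pochhammer_of_nat_eq_0_lemma[OF \<open>M < ?n - 1\<close>] False by simp
  qed
  have "poly (hypersimplex_ehrhart k ?n) (real t) =
    (\<Sum>j\<le>k. (-1) ^ j * real (?n choose j) * (pochhammer (1 - real j + real (k - j) * real t) (?n - 1) / fact (?n - 1)))"
    by (simp add: hypersimplex_ehrhart_def poly_sum poly_pcompose poly_pochhammer mult.commute)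
  also have "\<dots> = (\<Sum>j\<le>k. (-1) ^ j * real (?n choose j) * ?b j)"
    using summand by (intro sum.cong refl) simp
  \<comment> \<open>For \<open>j > k\<close> even \<open>j * t\<close> exceeds \<open>k * t\<close>,
    so the guard fails and the range can be extended to \<open>n\<close>.\<close>
  also have "\<dots> = (\<Sum>j\<le>?n. (-1) ^ j * real (?n choose j) * ?b j)"
  proof (intro sum.mono_neutral_left ballI)
    fix j assume "j \<in> {..?n} - {..k}"
    then have "k * t < j * t" using t by simp
    then have "\<not> j * Suc t \<le> k * t" unfolding mult_Suc_right by linarith
    then show "(-1) ^ j * real (?n choose j) * ?b j = 0" by simp
  qed (use assms in auto)
  also have "\<dots> = fps_nth ((\<Sum>i<Suc t. fps_X ^ i) ^ ?n) (k * t)"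
    by (rule fps_nth_geometric_sum_power[symmetric]) simp
  finally show "poly (hypersimplex_ehrhart k ?n) (real t) =
    real (card ((*\<^sub>R) (real t) ` (hypersimplex k :: (real ^ 'n) set) \<inter> integer_lattice))"
    by (simp only: card_lattice_points_hypersimplex[OF t])
qed

lemma coeff_hypersimplex_ehrhart:
  "fact (n - 1) * coeff (hypersimplex_ehrhart k n) m =
    (\<Sum>j\<le>k. (-1) ^ j * real (n choose j) * coeff (pochhammer [:1 - of_nat j, 1:] (n - 1)) m * real (k - j) ^ m)"
  by (simp add: hypersimplex_ehrhart_def coeff_sum coeff_pcompose_linear sum_distrib_left mult_ac)

section \<open>Comparison of coefficients\<close>

text \<open>\<open>fps_const\<close> is a ring homomorphism, so it commutes with the recurrence for
  the coefficients. This turns the coefficients found with \<open>x = fps_X\<close> into real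
  constants.\<close>

lemma coeff_pochhammer_fps_const:
  fixes a :: "'a :: comm_ring_1"
  shows "coeff (pochhammer [:fps_const a, 1:] n) m = fps_const (coeff (pochhammer [:a, 1:] n) m)"
proof (induction n arbitrary: m)
  case 0
  show ?case by (simp add: one_pCons coeff_pCons split: nat.split)
next
  case (Suc n)
  have "coeff (pochhammer [:a, 1:] (Suc n)) m =
    (a + of_nat n) * coeff (pochhammer [:a, 1:] n) m + (case m of 0 \<Rightarrow> 0 | Suc i \<Rightarrow> coeff (pochhammer [:a, 1:] n) i)"
    for a :: "'b :: comm_ring_1"
    by (simp add: pochhammer_rec' of_nat_poly coeff_pCons)
  from this[of "fps_const a"] this[of a] show ?case
    by (simp add: Suc.IH fps_of_nat[symmetric] split: nat.split)
qed

text \<open>Once \<open>\<sigma>\<close> with \<open>Suc m\<close> cycles is fixed, \<open>p\<close>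
  and \<open>w\<close> vary independently and their statistics add, so the generating function
  factors. Compatibility with the all-ones tuple bounds the weight of each cycle by its
  length.\<close>

lemma card_cow_perms_fps:
  "real (card {(\<sigma>, p, w). of_type n (Suc m) k (\<sigma>, p, w) \<and> compatible n (\<lambda>_. 1) (\<sigma>, p, w)}) =
    fps_nth ((\<Sum>p | p permutes {1..Suc m} \<and> p (Suc m) = 1. fps_X ^ des (Suc m) p) *
      (\<Sum>\<sigma> | \<sigma> permutes {1..n} \<and> card (orbit \<sigma> ` {1..n}) = Suc m.
        \<Prod>c\<in>orbit \<sigma> ` {1..n}. \<Sum>i<card c. fps_X ^ i)) k"
proof -
  let ?P = "{p. p permutes {1..Suc m} \<and> p (Suc m) = 1}"
  let ?S = "{\<sigma>. \<sigma> permutes {1..n} \<and> card (orbit \<sigma> ` {1..n}) = Suc m}"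
  let ?W = "\<lambda>\<sigma>. PiE (orbit \<sigma> ` {1..n}) (\<lambda>c. {..<card c})"
  let ?T = "SIGMA \<sigma>:?S. ?P \<times> ?W \<sigma>"
  let ?h = "\<lambda>(\<sigma>, p, w). des (Suc m) p + total_weight n \<sigma> w"
  have finP: "finite ?P"
    by (rule finite_subset[OF _ finite_permutations[of "{1..Suc m}"]]) auto
  have finS: "finite ?S"
    by (rule finite_subset[OF _ finite_permutations[of "{1..n}"]]) auto
  have finW: "finite (?W \<sigma>)" for \<sigma> by (intro finite_PiE) auto
  have "{(\<sigma>, p, w). of_type n (Suc m) k (\<sigma>, p, w) \<and> compatible n (\<lambda>_. 1) (\<sigma>, p, w)} =
    {x\<in>?T. ?h x = k}"
  proof (rule set_eqI)
    fix x :: "(nat \<Rightarrow> nat) \<times> (nat \<Rightarrow> nat) \<times> (nat set \<Rightarrow> nat)"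
    obtain \<sigma> p w where x: "x = (\<sigma>, p, w)" by (cases x)
    have W: "w \<in> ?W \<sigma> \<longleftrightarrow> w \<in> orbit \<sigma> ` {1..n} \<rightarrow>\<^sub>E UNIV \<and> (\<forall>c\<in>orbit \<sigma> ` {1..n}. w c < card c)"
      by (auto simp: PiE_iff)
    have "x \<in> {x\<in>?T. ?h x = k} \<longleftrightarrow> \<sigma> \<in> ?S \<and> p \<in> ?P \<and> w \<in> ?W \<sigma> \<and> ?h x = k"
      by (simp add: x)
    moreover have "x \<in> {(\<sigma>, p, w). of_type n (Suc m) k (\<sigma>, p, w) \<and> compatible n (\<lambda>_. 1) (\<sigma>, p, w)} \<longleftrightarrow>
      \<sigma> \<in> ?S \<and> p \<in> ?P \<and> w \<in> ?W \<sigma> \<and> ?h x = k"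
      unfolding x W of_type_def compatible_def cow_perm_def perm_cycles_def Let_def
      by (simp only: mem_Collect_eq case_prod_conv card_eq_sum) (metis add.commute)
    ultimately show "x \<in> {(\<sigma>, p, w). of_type n (Suc m) k (\<sigma>, p, w) \<and> compatible n (\<lambda>_. 1) (\<sigma>, p, w)} \<longleftrightarrow>
      x \<in> {x\<in>?T. ?h x = k}" by simp
  qed
  then have "real (card {(\<sigma>, p, w). of_type n (Suc m) k (\<sigma>, p, w) \<and> compatible n (\<lambda>_. 1) (\<sigma>, p, w)}) =
    fps_nth (\<Sum>x\<in>?T. fps_X ^ ?h x) k"
    using finP finS finW by (simp only: fps_nth_sum_X_power finite_SigmaI finite_cartesian_product)
  also have "(\<Sum>x\<in>?T. fps_X ^ ?h x) = (\<Sum>\<sigma>\<in>?S. \<Sum>y\<in>?P \<times> ?W \<sigma>. fps_X ^ ?h (\<sigma>, y))"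
    using finP finS finW by (subst sum.Sigma) (auto simp: case_prod_beta)
  also have "\<dots> = (\<Sum>\<sigma>\<in>?S. (\<Sum>p\<in>?P. fps_X ^ des (Suc m) p) * (\<Sum>w\<in>?W \<sigma>. fps_X ^ total_weight n \<sigma> w))"
    unfolding sum_product sum.cartesian_product by (simp add: power_add case_prod_beta)
  also have "\<dots> = (\<Sum>\<sigma>\<in>?S. (\<Sum>p\<in>?P. fps_X ^ des (Suc m) p) * (\<Prod>c\<in>orbit \<sigma> ` {1..n}. \<Sum>i<card c. fps_X ^ i))"
    by (simp add: prod_sum_PiE total_weight_def perm_cycles_def power_sum)
  finally show ?thesis by (simp only: sum_distrib_left)
qed

theorem theorem2p2:
  fixes n k m :: nat
  assumes "CARD('n::finite) = n"
    and "n \<ge> 2"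
    and "1 \<le> k" and "k \<le> n - 1"
    and "m \<le> n - 1"
  shows "coeff (smult (fact (n - 1)) (ehrhart_poly (hypersimplex k :: (real ^ 'n) set))) m =
           real (card {(\<sigma>, p, w).
             of_type n (m + 1) k (\<sigma>, p, w) \<and> compatible n (\<lambda>_. 1) (\<sigma>, p, w)})"
proof -
  let ?S = "{\<sigma>. \<sigma> permutes {1..n} \<and> card (orbit \<sigma> ` {1..n}) = Suc m}"
  let ?c = "\<lambda>j. coeff (pochhammer [:1 - of_nat j, 1 :: real:] (n - 1)) m"
  let ?G = "Abs_fps (\<lambda>s. of_nat s ^ m :: real)"
  have "ehrhart_poly (hypersimplex k :: (real ^ 'n) set) = hypersimplex_ehrhart k n"
    using assms is_ehrhart_poly_hypersimplex[where 'n='n and k=k] by (intro ehrhart_poly_eqI) auto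
  then have lhs: "coeff (smult (fact (n - 1)) (ehrhart_poly (hypersimplex k :: (real ^ 'n) set))) m =
    (\<Sum>j\<le>k. (-1) ^ j * real (n choose j) * ?c j * real (k - j) ^ m)"
    by (simp only: coeff_smult coeff_hypersimplex_ehrhart)
  \<comment> \<open>There are exactly \<open>Suc m\<close> cycles, so each receives one factor
    \<open>1 - fps_X\<close>, which closes its geometric sum to
    \<open>1 - fps_X ^ card c\<close>.\<close>
  have "(1 - fps_X) ^ Suc m * (\<Sum>\<sigma>\<in>?S. \<Prod>c\<in>orbit \<sigma> ` {1..n}. \<Sum>i<card c. fps_X ^ i) =
    (\<Sum>\<sigma>\<in>?S. \<Prod>c\<in>orbit \<sigma> ` {1..n}. 1 - fps_X ^ card c :: real fps)"
  proof -
    have "(\<Prod>c\<in>orbit \<sigma> ` {1..n}. 1 - fps_X ^ card c :: real fps) =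
      (1 - fps_X) ^ Suc m * (\<Prod>c\<in>orbit \<sigma> ` {1..n}. \<Sum>i<card c. fps_X ^ i)" if "\<sigma> \<in> ?S" for \<sigma>
      using that by (simp add: one_diff_power_eq prod.distrib)
    then show ?thesis by (simp add: sum_distrib_left)
  qed
  also have "\<dots> = (\<Sum>j\<le>n. of_nat (n choose j) * ((- fps_X) ^ j * coeff (pochhammer [:1 - of_nat j, 1:] (n - 1)) m))"
    using sum_permutes_fixed_cycles[where S="{1..n}" and m=m and x="fps_X :: real fps"] assms(2) by simp
  also have "\<dots> = (\<Sum>j\<le>n. fps_const ((-1) ^ j * real (n choose j) * ?c j) * fps_X ^ j)"
  proof (intro sum.cong refl)
    fix j
    have "1 - of_nat j = (fps_const (1 - of_nat j) :: real fps)"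
      by (simp add: fps_of_nat[symmetric] fps_const_sub[symmetric] del: fps_const_sub)
    moreover have "fps_const ((-1) ^ j * real (n choose j) * ?c j) =
      (-1) ^ j * of_nat (n choose j) * fps_const (?c j)"
      by (simp add: fps_of_nat[symmetric] fps_const_mult[symmetric] fps_const_power[symmetric] fps_const_neg[symmetric] del: fps_const_mult fps_const_power fps_const_neg)
    ultimately show "of_nat (n choose j) * ((- fps_X) ^ j * coeff (pochhammer [:1 - of_nat j, 1:] (n - 1)) m) =
      fps_const ((-1) ^ j * real (n choose j) * ?c j) * fps_X ^ j"
      by (simp only: coeff_pochhammer_fps_const power_minus[of fps_X] mult_ac)
  qed
  finally have cycles: "(1 - fps_X) ^ Suc m * (\<Sum>\<sigma>\<in>?S. \<Prod>c\<in>orbit \<sigma> ` {1..n}. \<Sum>i<card c. fps_X ^ i) =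
    (\<Sum>j\<le>n. fps_const ((-1) ^ j * real (n choose j) * ?c j) * fps_X ^ j)" .
  \<comment> \<open>The factor \<open>(1 - fps_X) ^ Suc m\<close> supplied by the Eulerian identity
    is the one absorbed by the cycles.\<close>
  have "real (card {(\<sigma>, p, w). of_type n (Suc m) k (\<sigma>, p, w) \<and> compatible n (\<lambda>_. 1) (\<sigma>, p, w)}) =
    fps_nth ((\<Sum>j\<le>n. fps_const ((-1) ^ j * real (n choose j) * ?c j) * fps_X ^ j) * ?G) k"
    unfolding card_cow_perms_fps eulerian_fps cycles[symmetric] by (simp only: mult_ac)
  also have "\<dots> = fps_nth (\<Sum>j\<le>n. fps_const ((-1) ^ j * real (n choose j) * ?c j) * (fps_X ^ j * ?G)) k"
    by (simp only: sum_distrib_right mult.assoc)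
  \<comment> \<open>The case distinction matters for \<open>m = 0\<close>: truncated
    \<open>k - j\<close> would give \<open>0 ^ 0 = 1\<close> for \<open>j > k\<close>, whereas at
    \<open>j = k\<close> this value is the right one.\<close>
  also have "\<dots> = (\<Sum>j\<le>n. (-1) ^ j * real (n choose j) * ?c j * (if k < j then 0 else real (k - j) ^ m))"
    by (simp only: fps_sum_nth fps_mult_left_const_nth fps_X_power_mult_nth fps_nth_Abs_fps)
  also have "\<dots> = (\<Sum>j\<le>k. (-1) ^ j * real (n choose j) * ?c j * real (k - j) ^ m)"
    using assms by (intro sum.mono_neutral_cong_right) auto
  finally show ?thesis using lhs by simp
qed

end
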